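(* Let $0\le d\le n$, $r\ge3$, let $\lambda_1,\dots,\lambda_r\in\Lambda$ with $\sum_{i=1}^r|\lambda_i|=d(n-d)$, and let $(C,z_\bullet)$ be a stable genus zero curve with $r$ marked points and irreducible components $C_1,\dots,C_v$. Let $\nu_\bullet$ be an assignment of a partition $\nu(C_j,x)\in\Lambda$ to each component $C_j$ and each special point $x\in C_j$ such that $\nu(C_j,z_i)=\lambda_i$ whenever $z_i\in C_j$, and $\nu(C_j,w)=\nu(C_k,w)^C$ whenever $C_j$ and $C_k$ meet at the node $w$. Then $\prod_{j=1}^v\Omega(\nu(C_j,x_\bullet),x_\bullet)$ is empty unless $\sum_{x\in C_j}|\nu(C_j,x)|=d(n-d)$ for every component $C_j$ (sum over the special points $x$ of $C_j$).
   Context: Everything is over $\mathbb{C}$. $\Lambda$ is the set of partitions $\lambda=(\lambda_1\ge\dots\ge\lambda_d\ge0)$ with $\lambda_1\le n-d$; $|\lambda|=\sum\lambda_i$; $\lambda^C=(n-d-\lambda_d,\dots,n-d-\lambda_1)$; $I(\lambda)=\{\lambda_d+1,\lambda_{d-1}+2,\dots,\lambda_1+d\}\subseteq\{1,\dots,n\}$. For a complete flag $F_\bullet$ in an $n$-dimensional space, $\Omega(\lambda,F_\bullet)$ is the variety of $d$-planes $V$ with $\dim(V\cap F_i)\ge\#(I(\lambda)\cap\{n-i+1,\dots,n\})$ for all $i$. For $z=[w]\in\mathbb{P}^1=\mathbb{P}(\mathbb{C}^2)$ the osculating flag in $\mathbb{C}^n=\mathrm{Sym}^{n-1}\mathbb{C}^2$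 is $F_k(z)=w^{n-k}\cdot\mathrm{Sym}^{k-1}\mathbb{C}^2$, and $\Omega(\lambda,z)=\Omega(\lambda,F_\bullet(z))\subseteq G(d,n)$. A point of a component $C_j$ of $C$ is special if it is a marked point or a node of $C$. Identifying $C_j$ with $\mathbb{P}^1$, $\Omega(\nu(C_j,x_\bullet),x_\bullet)$ denotes $\bigcap_x\Omega(\nu(C_j,x),x)\subseteq G(d,n)$, the intersection over all special points $x$ of $C_j$. *)

theory Defs
  imports Complex_Main "HOL-Library.FuncSet" "HOL-Computational_Algebra.Polynomial"
begin

section \<open>Partitions in a \<open>d\<close> by \<open>n - d\<close> rectangle\<close>

text \<open>The list entry at position \<open>i - 1\<close> is the part \<open>\<lambda>\<^sub>i\<close>; exactly \<open>d\<close> parts are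
  listed, zero parts included.\<close>

definition rect_partitions :: "nat \<Rightarrow> nat \<Rightarrow> nat list set" where
  "rect_partitions d n =
     {l. length l = d \<and> sorted_wrt (\<ge>) l \<and> (\<forall>a\<in>set l. a \<le> n - d)}"

abbreviation part_size :: "nat list \<Rightarrow> nat" where
  "part_size l \<equiv> sum_list l"

definition part_compl :: "nat \<Rightarrow> nat \<Rightarrow> nat list \<Rightarrow> nat list" where
  "part_compl d n l = map (\<lambda>a. n - d - a) (rev l)"

text \<open>The \<open>i\<close>-th element of \<open>I(\<lambda>)\<close> is \<open>\<lambda>\<^sub>d\<^sub>+\<^sub>1\<^sub>-\<^sub>i + i\<close>.\<close>

definition index_set :: "nat \<Rightarrow> nat list \<Rightarrow> nat set" where
  "index_set d l = {l ! (d - i) + i | i. i \<in> {1..d}}"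


section \<open>Symmetric powers of the plane\<close>

text \<open>The symmetric algebra of \<open>\<complex>\<^sup>2\<close> is the polynomial ring in the two basis
  vectors \<open>X\<close>, \<open>Y\<close>, here the type \<open>complex poly poly\<close> with inner variable \<open>X\<close> and outer
  variable \<open>Y\<close>.\<close>

type_synonym form = "complex poly poly"

global_interpretation form: vector_space "\<lambda>c (p :: form). smult [:c:] p"
  by unfold_locales
    (simp_all add: smult_add_right smult_add_left[symmetric] mult.commute one_pCons[symmetric])

text \<open>The degree is an integer so that \<open>Sym (- 1) = {0}\<close>, which occurs as
  \<open>F\<^sub>0\<close> and, for \<open>n = 0\<close>, as the ambient space.\<close>

definition Sym :: "int \<Rightarrow> form set" where
  "Sym m = {p. \<forall>i j. coeff (coeff p i) j \<noteq> 0 \<longrightarrow> int (i + j) = m}"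

definition linear_form :: "complex \<times> complex \<Rightarrow> form" where
  "linear_form w = [:[:0, fst w:], [:snd w:]:]"


section \<open>The projective line and its osculating flags\<close>

definition proj_rel :: "complex \<times> complex \<Rightarrow> complex \<times> complex \<Rightarrow> bool" where
  "proj_rel u w \<longleftrightarrow> u \<noteq> (0, 0) \<and> w \<noteq> (0, 0) \<and> (\<exists>c. c \<noteq> 0 \<and> w = (c * fst u, c * snd u))"

lemma proj_rel_sym: "proj_rel u w \<Longrightarrow> proj_rel w u"
proof -
  assume "proj_rel u w"
  then obtain c where c: "c \<noteq> 0" "w = (c * fst u, c * snd u)" and nz: "u \<noteq> (0, 0)" "w \<noteq> (0, 0)"
    unfolding proj_rel_def by blast
  have "u = (inverse c * fst w, inverse c * snd w)"
    using c by (cases u) simp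
  with c nz show "proj_rel w u"
    unfolding proj_rel_def using nonzero_imp_inverse_nonzero by blast
qed

quotient_type P1 = "complex \<times> complex" / partial: proj_rel
proof (rule part_equivpI)
  show "\<exists>w. proj_rel w w"
    by (rule exI[of _ "(1, 0)"]) (auto simp: proj_rel_def intro!: exI[of _ 1])
  show "symp proj_rel"
    by (rule sympI) (rule proj_rel_sym)
  show "transp proj_rel"
  proof (rule transpI)
    fix t u w assume "proj_rel t u" "proj_rel u w"
    then obtain c e where "c \<noteq> 0" "u = (c * fst t, c * snd t)" "e \<noteq> 0"
        "w = (e * fst u, e * snd u)" "t \<noteq> (0, 0)" "w \<noteq> (0, 0)"
      unfolding proj_rel_def by blast
    then show "proj_rel t w"
      unfolding proj_rel_def by (intro conjI exI[of _ "e * c"]) auto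
  qed
qed

lemma smult_in_Sym: "q \<in> Sym m \<Longrightarrow> smult [:c:] q \<in> Sym m"
  by (auto simp: Sym_def)

lemma osculating_subset:
  assumes "proj_rel u w"
  shows "{linear_form w ^ m * q | q. q \<in> Sym a} \<subseteq> {linear_form u ^ m * q | q. q \<in> Sym a}"
proof -
  from assms obtain c where w: "w = (c * fst u, c * snd u)"
    unfolding proj_rel_def by blast
  have "linear_form w = smult [:c:] (linear_form u)"
    by (simp add: linear_form_def w)
  then have "linear_form w ^ m * q = linear_form u ^ m * smult [:c ^ m:] q" for q
    by (simp add: smult_power poly_const_pow)
  then show ?thesis
    using smult_in_Sym by blast
qed

lift_definition osculating_flag :: "nat \<Rightarrow> P1 \<Rightarrow> nat \<Rightarrow> form set" is
  "\<lambda>n w k. {linear_form w ^ (n - k) * q | q. q \<in> Sym (int k - 1)}"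
  by (intro ext subset_antisym osculating_subset) (auto intro: proj_rel_sym)


section \<open>Schubert varieties\<close>

definition Grass :: "nat \<Rightarrow> nat \<Rightarrow> form set set" where
  "Grass d n = {V. form.subspace V \<and> V \<subseteq> Sym (int n - 1) \<and> form.dim V = d}"

definition Schubert :: "nat \<Rightarrow> nat \<Rightarrow> nat list \<Rightarrow> (nat \<Rightarrow> form set) \<Rightarrow> form set set" where
  "Schubert d n l F =
     {V \<in> Grass d n. \<forall>i\<le>n. form.dim (V \<inter> F i) \<ge> card (index_set d l \<inter> {n - i + 1..n})}"


section \<open>Stable marked curves of genus zero\<close>

text \<open>A nodal curve with smooth rational components \<open>C 1, \<dots>, C v\<close> is given by its set
  of points \<open>\<Union>j\<in>{1..v}. C j\<close>, of some type \<open>'p\<close>, with the components as subsets that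
  overlap exactly in the nodes, and bijections \<open>\<phi> j\<close> from \<open>C j\<close> onto the projective
  line. The bijection \<open>\<phi> j\<close> is what gives the point set \<open>C j\<close> its structure of an
  algebraic curve, and is at the same time the chosen identification with the
  projective line.\<close>

definition nodes :: "nat \<Rightarrow> (nat \<Rightarrow> 'p set) \<Rightarrow> 'p set" where
  "nodes v C = {x. \<exists>j\<in>{1..v}. \<exists>k\<in>{1..v}. j \<noteq> k \<and> x \<in> C j \<inter> C k}"

text \<open>\<open>p\<^sub>a = (\<Sum>j. g\<^sub>j) + \<delta> - v + 1\<close> for a connected nodal curve with \<open>\<delta>\<close> nodes and
  \<open>v\<close> components of geometric genera \<open>g\<^sub>j\<close>; here all \<open>g\<^sub>j\<close> vanish.\<close>

definition arithmetic_genus :: "nat \<Rightarrow> (nat \<Rightarrow> 'p set) \<Rightarrow> int" where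
  "arithmetic_genus v C = int (card (nodes v C)) - int v + 1"

definition special_points ::
    "nat \<Rightarrow> (nat \<Rightarrow> 'p set) \<Rightarrow> nat \<Rightarrow> (nat \<Rightarrow> 'p) \<Rightarrow> nat \<Rightarrow> 'p set" where
  "special_points v C r z j = C j \<inter> (z ` {1..r} \<union> nodes v C)"

locale stable_genus_zero_curve =
  fixes v :: nat and C :: "nat \<Rightarrow> 'p set" and \<phi> :: "nat \<Rightarrow> 'p \<Rightarrow> P1"
    and r :: nat and z :: "nat \<Rightarrow> 'p"
  assumes nonempty: "v \<ge> 1"
    and components: "\<And>j. j \<in> {1..v} \<Longrightarrow> bij_betw (\<phi> j) (C j) UNIV"
    and finite_nodes: "finite (nodes v C)"
    and two_branches: "\<And>x. card {j \<in> {1..v}. x \<in> C j} \<le> 2"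
    and connected: "\<And>j k. j \<in> {1..v} \<Longrightarrow> k \<in> {1..v} \<Longrightarrow>
      (j, k) \<in> {(a, b). a \<in> {1..v} \<and> b \<in> {1..v} \<and> C a \<inter> C b \<noteq> {}}\<^sup>*"
    and genus_zero: "arithmetic_genus v C = 0"
    and marked_points: "\<And>i. i \<in> {1..r} \<Longrightarrow> z i \<in> (\<Union>j\<in>{1..v}. C j) - nodes v C"
    and marked_distinct: "inj_on z {1..r}"
    and stable: "\<And>j. j \<in> {1..v} \<Longrightarrow> card (special_points v C r z j) \<ge> 3"

end

theory Submission
  imports Defs "HOL-Computational_Algebra.Field_as_Ring" "Jordan_Normal_Form.Determinant"
begin

text \<open>Since \<open>|\<nu>| + |\<nu>\<^sup>C| = d (n - d)\<close> and a genus zero curve has one node less than components,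
  the component sums average to \<open>d (n - d)\<close>; if they are not all equal, one of them exceeds
  \<open>d (n - d)\<close>. The intersection over such a component is empty: for \<open>V\<close> in
  \<open>\<Omega>(\<lambda>, z)\<close> a basis of \<open>V\<close> adapted to the flag at \<open>z\<close> shows that the Wronskian of \<open>V\<close>, a nonzero
  form of degree \<open>d (n - d)\<close>, vanishes at \<open>z\<close> to order at least \<open>|\<lambda>|\<close>. Setting \<open>Y = 1\<close>, i.e.
  evaluating the outer variable at \<open>1\<close>, turns the form into a polynomial; at the point with
  \<open>fst w = 0\<close>, vanishing becomes a drop of the degree.\<close>

hide_const (open) Module.smult

section \<open>Bases adapted to a family of subsets\<close>

context vector_space
begin

text \<open>Greedy choice: the \<open>m\<close> vectors already chosen span a space of dimension at
  most \<open>m\<close>, so \<open>U m\<close>, of larger dimension, contains a vector outside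
  it.\<close>

lemma exists_independent_transversal:
  assumes "\<And>k. k < m \<Longrightarrow> k < dim (U k)"
  shows "\<exists>f. (\<forall>k<m. f k \<in> U k) \<and> inj_on f {..<m} \<and> independent (f ` {..<m})"
  using assms
proof (induction m)
  case 0
  show ?case by (simp add: independent_empty)
next
  case (Suc m)
  then obtain f where f: "\<forall>k<m. f k \<in> U k" "inj_on f {..<m}" "independent (f ` {..<m})"
    by (metis less_Suc_eq)
  have "\<not> U m \<subseteq> span (f ` {..<m})"
  proof
    assume "U m \<subseteq> span (f ` {..<m})"
    then have "dim (U m) \<le> card (f ` {..<m})"
      by (rule dim_le_card) simp
    also have "\<dots> \<le> m"
      using card_image_le[of "{..<m}" f] by simp
    finally show False
      using Suc.prems[of m] by simp
  qed
  then obtain u where u: "u \<in> U m" "u \<notin> span (f ` {..<m})"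
    by blast
  define g where "g = f(m := u)"
  have img: "g ` {..<Suc m} = insert u (f ` {..<m})"
    by (auto simp: g_def lessThan_Suc)
  have "independent (g ` {..<Suc m})"
    unfolding img by (rule independent_insertI[OF u(2) f(3)])
  moreover have "u \<notin> f ` {..<m}"
    using u(2) span_base[of u "f ` {..<m}"] by auto
  then have "inj_on g {..<Suc m}"
    using f(2) by (auto simp: g_def lessThan_Suc inj_on_def)
  moreover have "\<forall>k<Suc m. g k \<in> U k"
    using f(1) u(1) by (auto simp: g_def less_Suc_eq)
  ultimately show ?case by blast
qed

lemma independent_spans_if_card_dim:
  assumes "B \<subseteq> V" "independent B" "card B = dim V" "0 < dim V"
  shows "V \<subseteq> span B"
proof (rule ccontr)
  assume "\<not> V \<subseteq> span B"
  then obtain x where x: "x \<in> V" "x \<notin> span B" by blast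
  obtain A where A: "A \<subseteq> V" "independent A" "V \<subseteq> span A" "card A = dim V"
    using basis_exists by blast
  \<comment> \<open>By convention an infinite set has \<open>card\<close> 0, so the positive
    dimension gives finiteness of both sets.\<close>
  have "finite A" "finite B"
    using A(4) assms(3,4) card_ge_0_finite by metis+
  have "card (insert x B) \<le> card A"
    using independent_span_bound[OF \<open>finite A\<close>, of "insert x B"] x assms A(3)
      independent_insertI[of x B] by blast
  moreover have "x \<notin> B"
    using x(2) span_base[of x B] by auto
  ultimately show False
    using \<open>finite B\<close> A(4) assms(3) by simp
qed

text \<open>Meant for \<open>U k\<close> the intersection of \<open>V\<close> with a member of a
  flag: the \<open>k\<close>-th basis vector then has a prescribed vanishing order. The span is
  given in coordinates indexed by \<open>k\<close>, ready for matrices.\<close>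

lemma exists_adapted_basis:
  assumes "0 < dim V" and U: "\<And>k. k < dim V \<Longrightarrow> U k \<subseteq> V \<and> k < dim (U k)"
  obtains f where "\<And>k. k < dim V \<Longrightarrow> f k \<in> U k"
    and "\<And>x. x \<in> V \<Longrightarrow> \<exists>c. x = (\<Sum>k<dim V. scale (c k) (f k))"
proof -
  obtain f where f: "\<forall>k<dim V. f k \<in> U k" "inj_on f {..<dim V}" "independent (f ` {..<dim V})"
    using exists_independent_transversal[of "dim V" U] U by auto
  have "V \<subseteq> span (f ` {..<dim V})"
    using f U assms(1) by (intro independent_spans_if_card_dim) (auto simp: card_image)
  moreover have "\<exists>c. x = (\<Sum>k<dim V. scale (c k) (f k))" if "x \<in> span (f ` {..<dim V})" for x
  proof -
    have "x \<in> range (\<lambda>u. \<Sum>y\<in>f ` {..<dim V}. scale (u y) y)"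
      using that span_finite[of "f ` {..<dim V}"] by simp
    then obtain u where "x = (\<Sum>y\<in>f ` {..<dim V}. scale (u y) y)"
      by blast
    then have "x = (\<Sum>k<dim V. scale (u (f k)) (f k))"
      using f(2) by (simp add: sum.reindex)
    then show ?thesis by (rule exI[of _ "\<lambda>k. u (f k)"])
  qed
  ultimately show ?thesis
    using f(1) that by blast
qed

text \<open>Gaussian elimination: choose one vector for each value of \<open>\<delta>\<close>.
  Subtracting a multiple of the chosen vector lowers \<open>\<delta>\<close>, so by induction on
  \<open>\<delta>\<close> the chosen vectors span \<open>V\<close>.\<close>

lemma dim_le_card_degrees:
  fixes \<delta> :: "'b \<Rightarrow> nat"
  assumes V: "subspace V" and fin: "finite (\<delta> ` (V - {0}))"
    and cancel: "\<And>x y. \<lbrakk>x \<in> V; y \<in> V; x \<noteq> 0; y \<noteq> 0; \<delta> x = \<delta> y\<rbrakk> \<Longrightarrow>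
      \<exists>c. x - scale c y = 0 \<or> \<delta> (x - scale c y) < \<delta> x"
  shows "dim V \<le> card (\<delta> ` (V - {0}))"
proof -
  define f where "f = (\<lambda>e. SOME x. x \<in> V - {0} \<and> \<delta> x = e)"
  define D where "D = \<delta> ` (V - {0})"
  have f: "f e \<in> V - {0} \<and> \<delta> (f e) = e" if "e \<in> D" for e
    unfolding f_def by (rule someI_ex) (use that in \<open>auto simp: D_def\<close>)
  have "x \<in> span (f ` D)" if "x \<in> V" for x
    using that
  proof (induction "\<delta> x" arbitrary: x rule: less_induct)
    case less
    show ?case
    proof (cases "x = 0")
      case False
      with less.prems have D: "\<delta> x \<in> D" by (auto simp: D_def)
      obtain c where c: "x - scale c (f (\<delta> x)) = 0 \<or> \<delta> (x - scale c (f (\<delta> x))) < \<delta> x"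
        using cancel[of x "f (\<delta> x)"] f[OF D] less.prems False by auto
      have "x - scale c (f (\<delta> x)) \<in> V"
        using V less.prems f[OF D] by (auto intro: subspace_diff subspace_scale)
      with c less.hyps have "x - scale c (f (\<delta> x)) \<in> span (f ` D)"
        by (metis span_zero)
      moreover have "scale c (f (\<delta> x)) \<in> span (f ` D)"
        using D by (intro span_scale span_base) auto
      ultimately show ?thesis
        using span_add by fastforce
    qed (simp add: span_zero)
  qed
  then have "dim V \<le> card (f ` D)"
    using fin by (intro dim_le_card) (auto simp: D_def)
  also have "\<dots> \<le> card D"
    using fin by (intro card_image_le) (simp add: D_def)
  finally show ?thesis by (simp add: D_def)
qed

end

section \<open>Wronskians\<close>

lemma coeff_mult_degree_le:
  fixes p q :: "'a::comm_semiring_1 poly"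
  assumes "degree p \<le> a" "degree q \<le> b"
  shows "coeff (p * q) (a + b) = coeff p a * coeff q b"
proof (cases "degree p = a \<and> degree q = b")
  case True
  then show ?thesis using coeff_mult_degree_sum by blast
next
  case False
  then have "degree p + degree q < a + b" and z: "coeff p a = 0 \<or> coeff q b = 0"
    using assms by (auto simp: coeff_eq_0)
  then have "coeff (p * q) (a + b) = 0"
    by (intro coeff_eq_0) (use degree_mult_le le_less_trans in blast)
  with z show ?thesis by auto
qed

lemma coeff_prod_degree_le:
  fixes g :: "'b \<Rightarrow> 'a::comm_semiring_1 poly"
  assumes "finite S" "\<And>k. k \<in> S \<Longrightarrow> degree (g k) \<le> N k"
  shows "coeff (prod g S) (sum N S) = (\<Prod>k\<in>S. coeff (g k) (N k))"
  using assms
proof (induction S rule: finite_induct)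
  case (insert k S)
  have "degree (prod g S) \<le> (\<Sum>k\<in>S. degree (g k))"
    using degree_prod_sum_le[OF insert.hyps(1), of g] by (simp add: comp_def)
  also have "\<dots> \<le> sum N S"
    using insert.prems by (intro sum_mono) auto
  finally show ?case
    using insert by (simp add: coeff_mult_degree_le)
qed simp

lemma coeff_signof_mult: "coeff (signof p * q) m = signof p * coeff q m"
  using signof_pm_one[of p, where 'a = int] by auto

lemma sum_permutes_atLeast0:
  fixes d :: nat
  assumes "p permutes {0..<d}"
  shows "(\<Sum>k = 0..<d. p k) = \<Sum>{..<d}"
  using sum.permute[OF assms, of "\<lambda>k. k", symmetric] by (simp only: comp_def lessThan_atLeast0)

text \<open>Rows belong to the functions and columns to the orders of the derivative, so that a
  linear change of the functions multiplies the matrix from the left.\<close>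

definition wronskian :: "nat \<Rightarrow> (nat \<Rightarrow> 'a::idom poly) \<Rightarrow> 'a poly" where
  "wronskian d f = det (mat d d (\<lambda>(k, i). (pderiv ^^ i) (f k)))"

text \<open>The Leibniz expansion, which allows vanishing orders and degrees to be estimated one
  permutation at a time.\<close>

lemma wronskian_altdef:
  "wronskian d f = (\<Sum>p | p permutes {0..<d}. signof p * (\<Prod>k = 0..<d. (pderiv ^^ p k) (f k)))"
  unfolding wronskian_def
  by (subst det_def'[of _ d]) (auto intro!: sum.cong prod.cong dest: permutes_in_image)

section \<open>Vanishing order, degree and change of basis\<close>

lemma linear_power_dvd_higher_pderiv:
  fixes f :: "'a::idom poly"
  assumes "[:a, 1:] ^ e dvd f"
  shows "[:a, 1:] ^ (e - i) dvd (pderiv ^^ i) f"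
proof (induction i)
  case (Suc i)
  show ?case
  proof (cases "e - i")
    case (Suc m)
    with Suc.IH obtain q where "(pderiv ^^ i) f = [:a, 1:] ^ Suc m * q"
      by (auto elim: dvdE)
    then have "pderiv ((pderiv ^^ i) f) =
        [:a, 1:] ^ m * ([:a, 1:] * pderiv q + smult (of_nat (Suc m)) q)"
      by (simp only: pderiv_mult pderiv_power_Suc pderiv_pCons)
        (simp add: algebra_simps pderiv_pCons)
    moreover have "e - Suc i = m" using Suc by simp
    ultimately show ?thesis by simp
  qed simp
qed (use assms in simp)

text \<open>A derivative of order \<open>p k\<close> costs at most \<open>p k\<close> zeros. Since
  \<open>p\<close> is a permutation, each Leibniz term loses at most \<open>\<Sum>{..<d}\<close>
  zeros in total.\<close>

lemma linear_power_dvd_wronskian: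
  fixes f :: "nat \<Rightarrow> 'a::idom poly"
  assumes dvd: "\<And>k. k < d \<Longrightarrow> [:a, 1:] ^ e k dvd f k" and s: "s + \<Sum>{..<d} \<le> (\<Sum>k<d. e k)"
  shows "[:a, 1:] ^ s dvd wronskian d f"
  unfolding wronskian_altdef
proof (rule dvd_sum, rule dvd_mult)
  fix p assume "p \<in> {p. p permutes {0..<d}}"
  then have p: "p permutes {0..<d}" by simp
  \<comment> \<open>Truncated subtraction can only increase \<open>e k - p k\<close>, so the
    estimate needs no case distinction.\<close>
  have "(\<Sum>k<d. e k) \<le> (\<Sum>k = 0..<d. (e k - p k) + p k)"
    unfolding lessThan_atLeast0 by (intro sum_mono) auto
  then have "s \<le> (\<Sum>k = 0..<d. e k - p k)"
    using s sum_permutes_atLeast0[OF p] by (simp add: sum.distrib)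
  then have "[:a, 1:] ^ s dvd [:a, 1:] ^ (\<Sum>k = 0..<d. e k - p k)"
    by (rule le_imp_power_dvd)
  also have "\<dots> = (\<Prod>k = 0..<d. [:a, 1:] ^ (e k - p k))"
    by (simp add: power_sum)
  also have "\<dots> dvd (\<Prod>k = 0..<d. (pderiv ^^ p k) (f k))"
    using dvd by (intro prod_dvd_prod linear_power_dvd_higher_pderiv) auto
  finally show "[:a, 1:] ^ s dvd (\<Prod>k = 0..<d. (pderiv ^^ p k) (f k))" .
qed

lemma degree_wronskian_le:
  fixes f :: "nat \<Rightarrow> 'a::{idom, semiring_char_0} poly"
  assumes deg: "\<And>k. k < d \<Longrightarrow> degree (f k) \<le> D k" and s: "(\<Sum>k<d. D k) \<le> s + \<Sum>{..<d}"
  shows "degree (wronskian d f) \<le> s"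
  unfolding wronskian_altdef
proof (rule degree_sum_le)
  fix p assume "p \<in> {p. p permutes {0..<d}}"
  then have p: "p permutes {0..<d}" by simp
  have "degree (\<Prod>k = 0..<d. (pderiv ^^ p k) (f k)) \<le> s"
  \<comment> \<open>If every \<open>p k\<close> is at most \<open>D k\<close>, the subtractions are
    exact and the sums can be split. Otherwise some factor is differentiated more often than its
    degree allows, and the whole product is 0.\<close>
  proof (cases "\<forall>k<d. p k \<le> D k")
    case True
    have "degree (\<Prod>k = 0..<d. (pderiv ^^ p k) (f k)) \<le> (\<Sum>k = 0..<d. degree ((pderiv ^^ p k) (f k)))"
      using degree_prod_sum_le[of "{0..<d}" "\<lambda>k. (pderiv ^^ p k) (f k)"] by (simp add: comp_def)
    also have "\<dots> \<le> (\<Sum>k = 0..<d. D k - p k)"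
      using deg by (intro sum_mono) (auto simp: degree_higher_pderiv intro: diff_le_mono)
    also have "\<dots> = (\<Sum>k = 0..<d. D k) - (\<Sum>k = 0..<d. p k)"
      using True by (intro sum_subtractf_nat) auto
    also have "\<dots> \<le> s"
      using s sum_permutes_atLeast0[OF p] by (simp add: lessThan_atLeast0)
    finally show ?thesis .
  next
    case False
    then obtain k where "k < d" "D k < p k" by (auto simp: not_le)
    with deg[of k] have "(pderiv ^^ p k) (f k) = 0"
      by (intro poly_eqI) (auto simp: coeff_higher_pderiv coeff_eq_0)
    with \<open>k < d\<close> have "(\<Prod>k = 0..<d. (pderiv ^^ p k) (f k)) = 0"
      by (intro prod_zero bexI[of _ k]) auto
    then show ?thesis by (simp only: degree_0)
  qed
  then show "degree (signof p * (\<Prod>k = 0..<d. (pderiv ^^ p k) (f k))) \<le> s"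
    using signof_pm_one[of p, where 'a = int] by auto
qed (simp add: finite_permutations)

text \<open>Differentiation commutes with constant coefficients, so the Wronskian matrix of
  \<open>f\<close> is a constant matrix times that of \<open>g\<close>, and determinants
  multiply.\<close>

lemma wronskian_linear_combination:
  fixes f g :: "nat \<Rightarrow> 'a::idom poly"
  assumes "\<And>k. k < d \<Longrightarrow> f k = (\<Sum>l<d. smult (c k l) (g l))"
  shows "wronskian d f = smult (det (mat d d (\<lambda>(k, l). c k l))) (wronskian d g)"
proof -
  interpret const: comm_ring_hom "\<lambda>x::'a. [:x:]"
    by unfold_locales (simp_all add: one_pCons)
  let ?c = "mat d d (\<lambda>(k, l). c k l)" and ?W = "\<lambda>f. mat d d (\<lambda>(k, i). (pderiv ^^ i) (f k))"
  have "?W f = map_mat (\<lambda>x. [:x:]) ?c * ?W g"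
    using assms by (intro eq_matI)
      (auto simp: scalar_prod_def higher_pderiv_sum higher_pderiv_smult lessThan_atLeast0)
  then have "wronskian d f = det (map_mat (\<lambda>x. [:x:]) ?c) * wronskian d g"
    unfolding wronskian_def by (simp add: det_mult[of _ d])
  then show ?thesis
    by (simp add: const.hom_det)
qed

section \<open>Nonvanishing of the Wronskian\<close>

lemma falling_product_sum_eq_0:
  fixes c :: "nat \<Rightarrow> 'a::{idom, ring_char_0}"
  assumes inj: "inj_on D {..<d}"
    and zero: "\<And>k. k < d \<Longrightarrow> (\<Sum>i<d. c i * (\<Prod>j<i. of_nat (D k) - of_nat j)) = 0"
    and i: "i < d"
  shows "c i = 0"
proof (rule ccontr)
  assume "c i \<noteq> 0"
  define m where "m = Max {i. i < d \<and> c i \<noteq> 0}"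
  have "m \<in> {i. i < d \<and> c i \<noteq> 0}"
    unfolding m_def by (rule Max_in) (use i \<open>c i \<noteq> 0\<close> in auto)
  then have m: "m < d" "c m \<noteq> 0" by auto
  have above: "c i = 0" if "m < i" "i < d" for i
    using that Max_ge[of "{i. i < d \<and> c i \<noteq> 0}" i] by (fastforce simp: m_def)
  \<comment> \<open>The falling factorials as monic polynomials of degree \<open>i\<close>. Their
    combination \<open>P\<close> has value 0 at every \<open>D k\<close>, by the assumption
    \<open>zero\<close>.\<close>
  define q where "q = (\<lambda>i. \<Prod>j<i. [:- of_nat j, 1:] :: 'a poly)"
  define P where "P = (\<Sum>i<d. smult (c i) (q i))"
  have deg: "degree (q i) = i" for i
    unfolding q_def by (subst degree_prod_sum_eq) auto
  have lead: "coeff (q i) i = 1" for i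
    using lead_coeff_prod[of "\<lambda>j. [:- of_nat j, 1:] :: 'a poly" "{..<i}"] deg[of i]
    by (simp add: q_def)
  \<comment> \<open>Terms beyond \<open>m\<close> have coefficient 0, those before \<open>m\<close>
    have smaller degree, and \<open>q m\<close> is monic.\<close>
  have "coeff P m = (\<Sum>i<d. if i = m then c m else 0)"
    unfolding P_def coeff_sum
    using above by (intro sum.cong refl) (auto simp: lead coeff_eq_0 deg neq_iff)
  with m have "coeff P m = c m" by simp
  with m have "P \<noteq> 0" by auto
  have "degree P \<le> d - 1"
    unfolding P_def
    by (intro degree_sum_le) (auto simp: deg intro!: order.trans[OF degree_smult_le])
  have "of_nat ` D ` {..<d} \<subseteq> {x. poly P x = 0}"
    using zero by (auto simp: P_def q_def poly_sum poly_prod)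
  \<comment> \<open>Characteristic 0 keeps the \<open>d\<close> numbers \<open>D k\<close> distinct
    in the ring, giving \<open>P\<close> more roots than its degree \<open>d - 1\<close>
    permits.\<close>
  moreover have "card ((of_nat :: nat \<Rightarrow> 'a) ` D ` {..<d}) = d"
    using inj by (subst card_image) (auto simp: card_image inj_on_def)
  ultimately have "d \<le> card {x. poly P x = 0}"
    using card_mono[OF poly_roots_finite[OF \<open>P \<noteq> 0\<close>]] by metis
  also have "\<dots> \<le> degree P"
    by (rule card_poly_roots_bound[OF \<open>P \<noteq> 0\<close>])
  finally show False
    using \<open>degree P \<le> d - 1\<close> m(1) by linarith
qed

lemma strict_mono_on_lessThan_add_le:
  fixes D :: "nat \<Rightarrow> nat"
  assumes "strict_mono_on {..<d} D" "k + i < d"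
  shows "D k + i \<le> D (k + i)"
  using assms(2)
proof (induction i)
  case (Suc i)
  then have "D (k + i) < D (k + Suc i)"
    using assms(1) by (auto simp: strict_mono_on_def)
  with Suc show ?case by simp
qed simp

text \<open>The coefficient in the highest possible degree is a generalised Vandermonde determinant
  in the degrees.\<close>

lemma wronskian_nonzero:
  fixes f :: "nat \<Rightarrow> 'a::{idom, ring_char_0} poly"
  assumes nz: "\<And>k. k < d \<Longrightarrow> f k \<noteq> 0"
    and mono: "strict_mono_on {..<d} (\<lambda>k. degree (f k))"
  shows "wronskian d f \<noteq> 0"
proof -
  define D where "D k = degree (f k)" for k
  define M where "M = mat d d (\<lambda>(k, i). lead_coeff (f k) * (\<Prod>j<i. of_nat (D k) - of_nat j))"
  have M: "M \<in> carrier_mat d d" by (simp add: M_def)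
  have inj: "inj_on D {..<d}"
    using mono strict_mono_on_imp_inj_on by (simp add: D_def[abs_def])
  have entry: "coeff ((pderiv ^^ i) (f k)) (D k - i) = lead_coeff (f k) * (\<Prod>j<i. of_nat (D k) - of_nat j)"
    if "i \<le> D k" for k i
  proof -
    \<comment> \<open>The coefficient formula for iterated derivatives yields the rising product
      from \<open>D k - i + 1\<close> to \<open>D k\<close>; reversed, it is the falling
      product.\<close>
    have "pochhammer (of_nat (Suc (D k - i))) i = (\<Prod>j<i. of_nat (D k) - of_nat j :: 'a)"
      using that prod.nat_diff_reindex[of "\<lambda>j. of_nat (Suc (D k - i)) + of_nat j :: 'a" i, symmetric]
      unfolding pochhammer_prod lessThan_atLeast0[symmetric]
      by (simp add: of_nat_diff algebra_simps cong: prod.cong_simp)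
    then show ?thesis
      using that by (simp add: coeff_higher_pderiv D_def mult.commute)
  qed
  have "coeff (wronskian d f) ((\<Sum>k<d. D k) - \<Sum>{..<d}) = det M"
    unfolding wronskian_altdef coeff_sum det_def'[OF M]
  proof (rule sum.cong, rule refl)
    fix p assume "p \<in> {p. p permutes {0..<d}}"
    then have p: "p permutes {0..<d}" by simp
    then have pd: "p k < d" if "k < d" for k using that permutes_in_image[OF p] by simp
    have "coeff (\<Prod>k = 0..<d. (pderiv ^^ p k) (f k)) ((\<Sum>k<d. D k) - \<Sum>{..<d})
        = (\<Prod>k = 0..<d. M $$ (k, p k))"
    proof (cases "\<forall>k<d. p k \<le> D k")
      case True
      then have "(\<Sum>k<d. D k) - \<Sum>{..<d} = (\<Sum>k = 0..<d. D k - p k)"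
        by (subst sum_subtractf_nat) (auto simp: sum_permutes_atLeast0[OF p] lessThan_atLeast0)
      then have "coeff (\<Prod>k = 0..<d. (pderiv ^^ p k) (f k)) ((\<Sum>k<d. D k) - \<Sum>{..<d})
          = (\<Prod>k = 0..<d. coeff ((pderiv ^^ p k) (f k)) (D k - p k))"
        by (simp add: coeff_prod_degree_le degree_higher_pderiv D_def)
      also have "\<dots> = (\<Prod>k = 0..<d. M $$ (k, p k))"
        using True pd by (intro prod.cong) (auto simp: entry M_def)
      finally show ?thesis .
    next
      case False
      then obtain k where k: "k < d" "D k < p k" by (auto simp: not_le)
      then have "(pderiv ^^ p k) (f k) = 0"
        by (intro poly_eqI) (auto simp: coeff_higher_pderiv coeff_eq_0 D_def)
      \<comment> \<open>For \<open>p k > D k\<close> the falling product contains the factor with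
        \<open>j = D k\<close>, so the matrix entry vanishes together with the derivative.\<close>
      moreover have "(\<Prod>j<p k. of_nat (D k) - of_nat j :: 'a) = 0"
        using k(2) by (intro prod_zero) auto
      then have "M $$ (k, p k) = 0"
        using k(1) pd[OF k(1)] by (simp add: M_def)
      ultimately have "(\<Prod>k = 0..<d. (pderiv ^^ p k) (f k)) = 0" "(\<Prod>k = 0..<d. M $$ (k, p k)) = 0"
        using k(1) by (intro prod_zero bexI[of _ k]; simp)+
      then show ?thesis by (simp only: coeff_0)
    qed
    then show "coeff (signof p * (\<Prod>k = 0..<d. (pderiv ^^ p k) (f k))) ((\<Sum>k<d. D k) - \<Sum>{..<d})
        = signof p * (\<Prod>k = 0..<d. M $$ (k, p k))"
      by (simp add: coeff_signof_mult)
  qed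
  moreover have "det M \<noteq> 0"
  proof
    assume "det M = 0"
    \<comment> \<open>A kernel vector of \<open>M\<close> is a combination of falling factorials
      that vanishes at all \<open>d\<close> distinct degrees, hence is trivial.\<close>
    then obtain w where w: "w \<in> carrier_vec d" "w \<noteq> 0\<^sub>v d" "M *\<^sub>v w = 0\<^sub>v d"
      using det_0_iff_vec_prod_zero[OF M] by blast
    have "w $ i = 0" if "i < d" for i
    proof (rule falling_product_sum_eq_0[OF inj _ that])
      fix k assume k: "k < d"
      have "0 = (M *\<^sub>v w) $ k"
        using w k by simp
      also have "\<dots> = lead_coeff (f k) * (\<Sum>i<d. w $ i * (\<Prod>j<i. of_nat (D k) - of_nat j))"
        using w(1) k by (simp add: M_def scalar_prod_def sum_distrib_left lessThan_atLeast0 ac_simps)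
      finally show "(\<Sum>i<d. w $ i * (\<Prod>j<i. of_nat (D k) - of_nat j)) = 0"
        using nz[OF k] by simp
    qed
    with w show False by (metis carrier_vecD eq_vecI index_zero_vec)
  qed
  ultimately show ?thesis by force
qed


section \<open>Dehomogenised forms\<close>

lemma poly_const_smult_1: "poly (smult [:c:] p) 1 = smult c (poly p 1)"
  by simp

text \<open>In a form of degree \<open>m\<close> the exponent \<open>j\<close> of \<open>X\<close>
  determines the exponent \<open>m - j\<close> of \<open>Y\<close>, so setting \<open>Y = 1\<close>
  merges no two monomials.\<close>

lemma coeff_poly_1_Sym:
  assumes "p \<in> Sym (int m)"
  shows "coeff (poly p 1) j = (if j \<le> m then coeff (coeff p (m - j)) j else 0)"
proof -
  have z: "coeff (coeff p i) j = 0" if "i + j \<noteq> m" for i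
    using assms that unfolding Sym_def by (metis (mono_tags, lifting) mem_Collect_eq of_nat_eq_iff)
  have "coeff (poly p 1) j = (\<Sum>i\<le>degree p. coeff (coeff p i) j)"
    by (simp add: poly_altdef coeff_sum)
  also have "\<dots> = (\<Sum>i\<in>{..degree p} \<inter> {i. i + j = m}. coeff (coeff p i) j)"
    by (rule sum.mono_neutral_right) (auto intro: z)
  also have "\<dots> = (if j \<le> m then coeff (coeff p (m - j)) j else 0)"
  proof (cases "j \<le> m \<and> m - j \<le> degree p")
    case True
    then have "{..degree p} \<inter> {i. i + j = m} = {m - j}" by auto
    with True show ?thesis by simp
  next
    case False
    then have "{..degree p} \<inter> {i. i + j = m} = {}" by auto
    with False show ?thesis by (auto simp: coeff_eq_0)
  qed
  finally show ?thesis .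
qed

lemma degree_poly_1_Sym: "p \<in> Sym (int m) \<Longrightarrow> degree (poly p 1) \<le> m"
  by (rule degree_le) (simp add: coeff_poly_1_Sym)

lemma poly_1_Sym_eq_0:
  assumes "p \<in> Sym (int m)" "poly p 1 = 0"
  shows "p = 0"
proof (rule poly_eqI, rule poly_eqI)
  fix i j
  show "coeff (coeff p i) j = coeff (coeff 0 i) j"
  proof (cases "i + j = m")
    case True
    then show ?thesis
      using coeff_poly_1_Sym[OF assms(1), of j] assms(2) by (auto simp: algebra_simps)
  next
    case False
    then show ?thesis
      using assms(1) unfolding Sym_def
      by (metis (mono_tags, lifting) coeff_0 mem_Collect_eq of_nat_eq_iff)
  qed
qed

lemma poly_1_linear_form: "poly (linear_form w) 1 = [:snd w, fst w:]"
  by (simp add: linear_form_def)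

lemma linear_dvd_poly_1_linear_form:
  assumes "fst w \<noteq> 0"
  shows "[:snd w / fst w, 1:] ^ e dvd poly (linear_form w ^ e * q) 1"
proof -
  have "[:snd w, fst w:] = smult (fst w) [:snd w / fst w, 1:]"
    using assms by simp
  then have "poly (linear_form w ^ e * q) 1 = smult (fst w ^ e) ([:snd w / fst w, 1:] ^ e * poly q 1)"
    by (simp only: poly_mult poly_power poly_1_linear_form smult_power mult_smult_left)
  then show ?thesis
    by (simp add: dvd_smult)
qed

text \<open>Here \<open>linear_form w\<close> is a multiple of \<open>Y\<close> and becomes a
  constant, so only \<open>q\<close> contributes to the degree.\<close>

lemma degree_poly_1_linear_form:
  assumes "fst w = 0" "q \<in> Sym (int m)"
  shows "degree (poly (linear_form w ^ e * q) 1) \<le> m"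
proof -
  have "poly (linear_form w ^ e * q) 1 = smult (snd w ^ e) (poly q 1)"
    using assms(1) by (simp add: poly_1_linear_form poly_const_pow)
  then show ?thesis
    using degree_poly_1_Sym[OF assms(2)] degree_smult_le order.trans by metis
qed

text \<open>Elimination of leading terms shows that at least \<open>d\<close> distinct degrees occur
  in \<open>V\<close>; one vector is taken for each of the \<open>d\<close> smallest, in increasing
  order.\<close>

lemma exists_basis_distinct_degrees:
  assumes "V \<in> Grass d n"
  obtains b where "\<And>k. k < d \<Longrightarrow> b k \<in> V" "\<And>k. k < d \<Longrightarrow> poly (b k) 1 \<noteq> 0"
    and "strict_mono_on {..<d} (\<lambda>k. degree (poly (b k) 1))"
    and "\<And>k. k < d \<Longrightarrow> degree (poly (b k) 1) < n"
proof (cases "n = 0")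
  case True
  \<comment> \<open>For \<open>n = 0\<close> the ambient space is \<open>Sym (- 1)\<close>, which is
    zero, so \<open>d = 0\<close> and all claims are vacuous.\<close>
  then have "Sym (int n - 1) = {0}"
    by (auto simp: Sym_def poly_eq_iff)
  then have "form.dim V = 0"
    using assms form.dim_le_card[of V "{}"] by (auto simp: Grass_def)
  then show ?thesis
    using assms that by (auto simp: Grass_def)
next
  case False
  then have n: "int n - 1 = int (n - 1)" by simp
  define \<delta> where "\<delta> p = degree (poly p 1)" for p :: form
  define D where "D = \<delta> ` (V - {0})"
  have V: "form.subspace V" "V \<subseteq> Sym (int (n - 1))" "form.dim V = d"
    using assms by (auto simp: Grass_def n)
  have D: "D \<subseteq> {..<n}"
  proof
    fix i assume "i \<in> D"
    then obtain p where "p \<in> V" "i = degree (poly p 1)" by (auto simp: D_def \<delta>_def)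
    with V(2) degree_poly_1_Sym[of p "n - 1"] False show "i \<in> {..<n}" by auto
  qed
  have "d \<le> card D"
    unfolding D_def V(3)[symmetric]
  proof (rule form.dim_le_card_degrees[OF V(1)])
    show "finite (\<delta> ` (V - {0}))"
      using D finite_subset by (auto simp: D_def)
  next
    fix x y assume xy: "x \<in> V" "y \<in> V" "x \<noteq> 0" "y \<noteq> 0" "\<delta> x = \<delta> y"
    \<comment> \<open>Chosen to cancel the leading terms of the dehomogenised forms, which have
      equal degree.\<close>
    define c where "c = lead_coeff (poly x 1) / lead_coeff (poly y 1)"
    have y0: "poly y 1 \<noteq> 0"
      using poly_1_Sym_eq_0 xy V(2) by blast
    have "x - smult [:c:] y \<in> V"
      using V(1) xy form.subspace_diff form.subspace_scale by blast
    then have S: "x - smult [:c:] y \<in> Sym (int (n - 1))"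
      using V(2) by blast
    have le: "\<delta> (x - smult [:c:] y) \<le> \<delta> x"
      unfolding \<delta>_def poly_diff poly_const_smult_1
      using xy(5) by (intro degree_diff_le) (auto simp: \<delta>_def intro: order.trans[OF degree_smult_le])
    have co: "coeff (poly (x - smult [:c:] y) 1) (\<delta> x) = 0"
      using xy(5) y0 by (simp add: c_def \<delta>_def)
    have "x - smult [:c:] y = 0 \<or> \<delta> (x - smult [:c:] y) < \<delta> x"
    proof (rule ccontr)
      assume *: "\<not> ?thesis"
      with le co have "lead_coeff (poly (x - smult [:c:] y) 1) = 0"
        by (simp add: \<delta>_def)
      then have "poly (x - smult [:c:] y) 1 = 0"
        by (simp only: leading_coeff_0_iff)
      with poly_1_Sym_eq_0[OF S] * show False by blast
    qed
    then show "\<exists>c. x - smult [:c:] y = 0 \<or> \<delta> (x - smult [:c:] y) < \<delta> x" ..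
  qed
  define s where "s = sorted_list_of_set D"
  have fin: "finite D" using D finite_subset by auto
  have s: "set s = D" "d \<le> length s" "sorted_wrt (<) s"
    using fin \<open>d \<le> card D\<close> by (auto simp: s_def)
  define b where "b k = (SOME p. p \<in> V - {0} \<and> \<delta> p = s ! k)" for k
  have b: "b k \<in> V - {0} \<and> \<delta> (b k) = s ! k" if "k < d" for k
  proof -
    have "s ! k \<in> D"
      using that s(1,2) nth_mem[of k s] by simp
    then have "\<exists>p. p \<in> V - {0} \<and> \<delta> p = s ! k" by (auto simp: D_def)
    then show ?thesis unfolding b_def by (rule someI_ex)
  qed
  show ?thesis
  proof (rule that)
    show "strict_mono_on {..<d} (\<lambda>k. degree (poly (b k) 1))"
      using b s(2,3) by (auto simp: strict_mono_on_def \<delta>_def sorted_wrt_iff_nth_less)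
  next
    fix k assume k: "k < d"
    show "b k \<in> V" using b[OF k] by simp
    show "poly (b k) 1 \<noteq> 0" using b[OF k] poly_1_Sym_eq_0 V(2) by blast
    show "degree (poly (b k) 1) < n"
      using b[OF k] D by (auto simp: D_def \<delta>_def)
  qed
qed

section \<open>Schubert conditions and the Wronskian\<close>

lemma rect_partitionsD:
  assumes "l \<in> rect_partitions d n"
  shows "length l = d" "j < d \<Longrightarrow> l ! j \<le> n - d" "i < j \<Longrightarrow> j < d \<Longrightarrow> l ! j \<le> l ! i"
  using assms by (auto simp: rect_partitions_def sorted_wrt_iff_nth_less)

text \<open>The parts \<open>l ! 0\<close> to \<open>l ! j\<close> give \<open>j + 1\<close>
  elements of the index set, the smallest being one more than \<open>l ! j + (d - Suc j)\<close>.
  The Schubert condition for the flag member of this codimension counts all of them.\<close>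

lemma Schubert_dim:
  assumes V: "V \<in> Schubert d n l F" and l: "l \<in> rect_partitions d n" and "d \<le> n" and j: "j < d"
  shows "j < form.dim (V \<inter> F (n - (l ! j + (d - Suc j))))"
proof -
  define e where "e = l ! j + (d - Suc j)"
  have "e < n"
    using rect_partitionsD(2)[OF l j] j \<open>d \<le> n\<close> by (simp add: e_def)
  then have idx: "n - (n - e) + 1 = Suc e" by simp
  define g where "g i = l ! i + (d - i)" for i
  have "g i \<in> index_set d l \<inter> {Suc e..n}" if "i \<le> j" for i
  proof -
    have "g i \<in> index_set d l"
      unfolding index_set_def g_def using that j by (auto intro!: exI[of _ "d - i"])
    moreover have "l ! j \<le> l ! i"
      using rect_partitionsD(3)[OF l, of i j] that j by (cases "i = j") auto
    ultimately show ?thesis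
      using that j \<open>d \<le> n\<close> rect_partitionsD(2)[OF l, of i] by (auto simp: g_def e_def)
  qed
  then have "g ` {..j} \<subseteq> index_set d l \<inter> {Suc e..n}" by auto
  moreover have "g a > g b" if "a < b" "b \<le> j" for a b
    using rect_partitionsD(3)[OF l, of a b] that j by (simp add: g_def)
  then have "inj_on g {..j}"
    by (intro linorder_inj_onI') force
  ultimately have "Suc j \<le> card (index_set d l \<inter> {Suc e..n})"
    using card_mono[of "index_set d l \<inter> {Suc e..n}" "g ` {..j}"] by (simp add: card_image)
  also have "\<dots> = card (index_set d l \<inter> {n - (n - e) + 1..n})"
    using idx by (simp only:)
  also have "\<dots> \<le> form.dim (V \<inter> F (n - e))"
    using V unfolding Schubert_def by (metis (mono_tags, lifting) diff_le_self mem_Collect_eq)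
  finally show ?thesis by (simp add: e_def)
qed

lemma osculating_flag_abs_P1:
  assumes "w \<noteq> (0, 0)"
  shows "osculating_flag n (abs_P1 w) k = {linear_form w ^ (n - k) * q | q. q \<in> Sym (int k - 1)}"
proof -
  have "proj_rel w w"
    using assms by (auto simp: proj_rel_def intro!: exI[of _ 1])
  then show ?thesis
    by (simp add: osculating_flag.abs_eq)
qed

text \<open>The osculating flag member of codimension \<open>e\<close> consists of the multiples of
  \<open>linear_form w ^ e\<close>, so each adapted basis vector splits off the power given by
  \<open>Schubert_dim\<close>.\<close>

lemma Schubert_osculating_adapted_basis:
  assumes V: "V \<in> Schubert d n l (osculating_flag n (abs_P1 w))" and w: "w \<noteq> (0, 0)"
    and l: "l \<in> rect_partitions d n" and "d \<le> n" "0 < d"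
  obtains q where "\<And>k. k < d \<Longrightarrow> q k \<in> Sym (int (n - Suc (l ! k + (d - Suc k))))"
    and "\<And>x. x \<in> V \<Longrightarrow>
      \<exists>c. x = (\<Sum>k<d. smult [:c k:] (linear_form w ^ (l ! k + (d - Suc k)) * q k))"
proof -
  define e where "e k = l ! k + (d - Suc k)" for k
  have e: "e k < n" if "k < d" for k
    using rect_partitionsD(2)[OF l that] that \<open>d \<le> n\<close> by (simp add: e_def)
  have dim: "form.dim V = d"
    using V by (simp add: Schubert_def Grass_def)
  obtain f where f: "\<And>k. k < d \<Longrightarrow> f k \<in> V \<inter> osculating_flag n (abs_P1 w) (n - e k)"
    and span: "\<And>x. x \<in> V \<Longrightarrow> \<exists>c. x = (\<Sum>k<d. smult [:c k:] (f k))"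
    using form.exists_adapted_basis[of V "\<lambda>k. V \<inter> osculating_flag n (abs_P1 w) (n - e k)"]
      Schubert_dim[OF V l \<open>d \<le> n\<close>] \<open>0 < d\<close> by (auto simp: dim e_def)
  have "\<exists>q. q \<in> Sym (int (n - Suc (e k))) \<and> f k = linear_form w ^ e k * q" if "k < d" for k
    using f[OF that] e[OF that]
    by (auto simp: osculating_flag_abs_P1[OF w] of_nat_diff algebra_simps)
  then obtain q where q: "\<And>k. k < d \<Longrightarrow> q k \<in> Sym (int (n - Suc (e k))) \<and> f k = linear_form w ^ e k * q k"
    by metis
  show ?thesis
  proof (rule that)
    show "q k \<in> Sym (int (n - Suc (l ! k + (d - Suc k))))" if "k < d" for k
      using q[OF that] by (simp add: e_def)
    show "\<exists>c. x = (\<Sum>k<d. smult [:c k:] (linear_form w ^ (l ! k + (d - Suc k)) * q k))" if "x \<in> V" for x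
    proof -
      obtain c where "x = (\<Sum>k<d. smult [:c k:] (f k))" using span[OF \<open>x \<in> V\<close>] by blast
      also have "\<dots> = (\<Sum>k<d. smult [:c k:] (linear_form w ^ e k * q k))"
        using q by (intro sum.cong) auto
      finally show ?thesis unfolding e_def by (rule exI[of _ c])
    qed
  qed
qed

text \<open>Lets the Wronskian of one fixed family \<open>b\<close> be compared with an adapted
  basis at each point separately. Divisibility and degree bounds pass to the multiple whatever the
  value of \<open>c\<close>.\<close>

lemma wronskian_adapted_basis:
  assumes V: "\<And>x. x \<in> V \<Longrightarrow> \<exists>c. x = (\<Sum>k<d. smult [:c k:] (f k))"
    and b: "\<And>k. k < d \<Longrightarrow> b k \<in> V"
  shows "\<exists>c. wronskian d (\<lambda>k. poly (b k) 1) = smult c (wronskian d (\<lambda>k. poly (f k) 1 :: complex poly))"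
proof -
  have "\<forall>k. \<exists>c. k < d \<longrightarrow> b k = (\<Sum>l<d. smult [:c l:] (f l))"
    using V b by blast
  then obtain c where c: "\<And>k. k < d \<Longrightarrow> b k = (\<Sum>l<d. smult [:c k l:] (f l))"
    by metis
  have "poly (b k) 1 = (\<Sum>l<d. smult (c k l) (poly (f l) 1))" if "k < d" for k
    by (simp add: c[OF that] poly_sum)
  from wronskian_linear_combination[of d "\<lambda>k. poly (b k) 1", OF this] show ?thesis by blast
qed

text \<open>The excess \<open>\<Sum>{..<d}\<close> over the size is exactly what the derivatives in
  the Wronskian cost.\<close>

lemma sum_partition_exponents:
  assumes "length l = d"
  shows "(\<Sum>k<d. l ! k + (d - Suc k)) = part_size l + \<Sum>{..<d}"
  using assms sum.nat_diff_reindex[of "\<lambda>k. k" d]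
  by (simp only: sum.distrib sum_list_sum_nth lessThan_atLeast0)

lemma Schubert_finite_point_dvd_wronskian:
  assumes V: "V \<in> Schubert d n l (osculating_flag n (abs_P1 w))" and w: "fst w \<noteq> 0"
    and l: "l \<in> rect_partitions d n" and d: "d \<le> n" "0 < d"
    and b: "\<And>k. k < d \<Longrightarrow> b k \<in> V"
  shows "[:snd w / fst w, 1:] ^ part_size l dvd wronskian d (\<lambda>k. poly (b k) 1)"
proof -
  have "w \<noteq> (0, 0)" using w by auto
  obtain q where "\<And>x. x \<in> V \<Longrightarrow>
      \<exists>c. x = (\<Sum>k<d. smult [:c k:] (linear_form w ^ (l ! k + (d - Suc k)) * q k))"
    by (rule Schubert_osculating_adapted_basis[OF V \<open>w \<noteq> (0, 0)\<close> l d]) blast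
  from wronskian_adapted_basis[where V = V and b = b, OF this b] obtain c where
    "wronskian d (\<lambda>k. poly (b k) 1) =
      smult c (wronskian d (\<lambda>k. poly (linear_form w ^ (l ! k + (d - Suc k)) * q k) 1))"
    by blast
  moreover have "[:snd w / fst w, 1:] ^ part_size l dvd
      wronskian d (\<lambda>k. poly (linear_form w ^ (l ! k + (d - Suc k)) * q k) 1)"
    using sum_partition_exponents[OF rect_partitionsD(1)[OF l]]
    by (intro linear_power_dvd_wronskian[where e = "\<lambda>k. l ! k + (d - Suc k)"]
        linear_dvd_poly_1_linear_form w) simp
  ultimately show ?thesis
    by (simp add: dvd_smult)
qed

lemma Schubert_infinity_degree_wronskian:
  assumes V: "V \<in> Schubert d n l (osculating_flag n (abs_P1 w))" and w: "w \<noteq> (0, 0)" "fst w = 0"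
    and l: "l \<in> rect_partitions d n" and d: "d \<le> n" "0 < d"
    and b: "\<And>k. k < d \<Longrightarrow> b k \<in> V"
  shows "degree (wronskian d (\<lambda>k. poly (b k) 1)) + part_size l \<le> d * (n - d)"
proof -
  define e where "e k = l ! k + (d - Suc k)" for k
  obtain q where q: "\<And>k. k < d \<Longrightarrow> q k \<in> Sym (int (n - Suc (e k)))"
    and "\<And>x. x \<in> V \<Longrightarrow> \<exists>c. x = (\<Sum>k<d. smult [:c k:] (linear_form w ^ e k * q k))"
    unfolding e_def by (rule Schubert_osculating_adapted_basis[OF V w(1) l d]) blast
  from wronskian_adapted_basis[where V = V and b = b, OF this(2) b] obtain c where
    c: "wronskian d (\<lambda>k. poly (b k) 1) = smult c (wronskian d (\<lambda>k. poly (linear_form w ^ e k * q k) 1))"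
    by blast
  have len: "length l = d" by (rule rect_partitionsD(1)[OF l])
  have le: "l ! k \<le> n - d" if "k < d" for k by (rule rect_partitionsD(2)[OF l that])
  have size: "part_size l = (\<Sum>k<d. l ! k)"
    by (simp add: len sum_list_sum_nth lessThan_atLeast0)
  have "(\<Sum>k<d. n - d - l ! k) + part_size l = (\<Sum>k<d. n - d - l ! k + l ! k)"
    by (simp add: size sum.distrib)
  also have "\<dots> = (\<Sum>k<d. n - d)"
    by (intro sum.cong refl le_add_diff_inverse2 le) simp
  finally have total: "(\<Sum>k<d. n - d - l ! k) + part_size l = d * (n - d)" by simp
  \<comment> \<open>The \<open>k\<close>-th adapted vector has degree at most
    \<open>n - Suc (e k)\<close>; the summands \<open>k\<close> are again absorbed by the
    derivatives.\<close>
  have "(\<Sum>k<d. n - Suc (e k)) = (\<Sum>k<d. (n - d - l ! k) + k)"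
    using le d by (intro sum.cong) (fastforce simp: e_def)+
  then have "degree (wronskian d (\<lambda>k. poly (linear_form w ^ e k * q k) 1)) \<le> (\<Sum>k<d. n - d - l ! k)"
    using degree_poly_1_linear_form[OF w(2) q]
    by (intro degree_wronskian_le[where D = "\<lambda>k. n - Suc (e k)"]) (simp_all add: sum.distrib)
  then have "degree (wronskian d (\<lambda>k. poly (b k) 1)) \<le> (\<Sum>k<d. n - d - l ! k)"
    unfolding c using degree_smult_le order.trans by blast
  with total show ?thesis by linarith
qed

section \<open>Counting zeros on one projective line\<close>

lemma degree_wronskian_distinct_degrees:
  fixes f :: "nat \<Rightarrow> 'a::{idom, semiring_char_0} poly"
  assumes mono: "strict_mono_on {..<d} (\<lambda>k. degree (f k))"
    and deg: "\<And>k. k < d \<Longrightarrow> degree (f k) < n"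
  shows "degree (wronskian d f) \<le> d * (n - d)"
proof (rule degree_wronskian_le[where D = "\<lambda>k. (n - d) + k"])
  fix k assume k: "k < d"
  \<comment> \<open>Above the \<open>k\<close>-th degree there are \<open>d - Suc k\<close> larger
    ones, all less than \<open>n\<close>.\<close>
  have "degree (f k) + (d - Suc k) \<le> degree (f (d - 1))"
    using strict_mono_on_lessThan_add_le[OF mono, of k "d - Suc k"] k by simp
  moreover have "degree (f (d - 1)) < n" using deg k by simp
  ultimately show "degree (f k) \<le> n - d + k" using k by linarith
qed (simp add: sum.distrib)

lemma sum_multiplicities_le_degree:
  fixes W :: "'a::field_gcd poly"
  assumes "W \<noteq> 0" "finite S" "inj_on a S" "\<And>x. x \<in> S \<Longrightarrow> [:a x, 1:] ^ m x dvd W"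
  shows "(\<Sum>x\<in>S. m x) \<le> degree W"
proof -
  have cop: "coprime [:a x, 1:] [:a y, 1:]" if "a x \<noteq> a y" for x y
  \<comment> \<open>A common divisor of two of the linear factors divides their difference, a
    nonzero constant. Hence the powers are coprime and their product divides
    \<open>W\<close>.\<close>
  proof (rule coprimeI)
    fix c assume "c dvd [:a x, 1:]" "c dvd [:a y, 1:]"
    then have "c dvd [:a x, 1:] - [:a y, 1:]" by (rule dvd_diff)
    also have "[:a x, 1:] - [:a y, 1:] = [:a x - a y:]" by simp
    finally show "is_unit c"
      using that by (metis dvd_trans is_unit_const_poly_iff dvd_field_iff right_minus_eq)
  qed
  have "(\<Prod>x\<in>S. [:a x, 1:] ^ m x) dvd W"
    using assms(2-4)
  proof (induction S rule: finite_induct)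
    case (insert x S)
    have "coprime ([:a x, 1:] ^ m x) (\<Prod>x\<in>S. [:a x, 1:] ^ m x)"
      by (intro prod_coprime_right coprime_power_left_iff[THEN iffD2]
          coprime_power_right_iff[THEN iffD2] disjI1 cop)
        (use insert.hyps insert.prems(1) in \<open>auto simp: inj_on_def\<close>)
    then show ?case
      using insert by (auto intro: divides_mult)
  qed simp
  then have "degree (\<Prod>x\<in>S. [:a x, 1:] ^ m x) \<le> degree W"
    using assms(1) by (rule dvd_imp_degree_le)
  moreover have "degree (\<Prod>x\<in>S. [:a x, 1:] ^ m x) = (\<Sum>x\<in>S. m x)"
    by (subst degree_prod_sum_eq) (auto simp: degree_linear_power)
  ultimately show ?thesis by simp
qed

lemma abs_P1_eqI:
  assumes "u \<noteq> (0, 0)" "w \<noteq> (0, 0)" "fst u * snd w = fst w * snd u"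
  shows "abs_P1 u = abs_P1 w"
proof -
  have "proj_rel u w"
  proof (cases "fst u = 0")
    case True
    then have "snd u \<noteq> 0" "fst w = 0" using assms by (auto simp: prod_eq_iff)
    then show ?thesis
      using assms True unfolding proj_rel_def
      by (intro conjI exI[of _ "snd w / snd u"]) (auto simp: prod_eq_iff)
  next
    case False
    with assms have "fst w \<noteq> 0" by (auto simp: prod_eq_iff)
    then show ?thesis
      using assms False unfolding proj_rel_def
      by (intro conjI exI[of _ "fst w / fst u"]) (auto simp: prod_eq_iff field_simps)
  qed
  then show ?thesis by (rule Quotient3_rel_abs[OF Quotient3_P1])
qed

lemma P1_representative: "\<exists>w. w \<noteq> (0, 0) \<and> P = abs_P1 w"
  by (induction P rule: P1.abs_induct) (auto simp: proj_rel_def)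

lemma Schubert_intersection_sum_le:
  assumes "finite S" "S \<noteq> {}" "inj_on \<psi> S" "d \<le> n"
    and l: "\<And>x. x \<in> S \<Longrightarrow> l x \<in> rect_partitions d n"
    and V: "\<And>x. x \<in> S \<Longrightarrow> V \<in> Schubert d n (l x) (osculating_flag n (\<psi> x))"
  shows "(\<Sum>x\<in>S. part_size (l x)) \<le> d * (n - d)"
\<comment> \<open>For \<open>d = 0\<close> all the lists are empty; adapted bases are available only
  in positive dimension.\<close>
proof (cases "d = 0")
  case True
  then show ?thesis
    using rect_partitionsD(1)[OF l] by simp
next
  case False
  then have "0 < d" by simp
  have "\<forall>x. \<exists>w. w \<noteq> (0, 0) \<and> \<psi> x = abs_P1 w"
    using P1_representative by blast
  then obtain w where w: "\<And>x. w x \<noteq> (0, 0)" "\<And>x. \<psi> x = abs_P1 (w x)"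
    by metis
  have inj: "x = y" if "x \<in> S" "y \<in> S" "fst (w x) * snd (w y) = fst (w y) * snd (w x)" for x y
    using abs_P1_eqI[OF w(1) w(1) that(3)] that(1,2)
    by (intro inj_onD[OF assms(3)]) (simp_all add: w(2))
  have V': "V \<in> Schubert d n (l x) (osculating_flag n (abs_P1 (w x)))" if "x \<in> S" for x
    using V[OF that] by (simp add: w(2))
  have "V \<in> Grass d n"
    using V assms(2) by (auto simp: Schubert_def)
  then obtain b where b: "\<And>k. k < d \<Longrightarrow> b k \<in> V" "\<And>k. k < d \<Longrightarrow> poly (b k) 1 \<noteq> 0"
      "strict_mono_on {..<d} (\<lambda>k. degree (poly (b k) 1))" "\<And>k. k < d \<Longrightarrow> degree (poly (b k) 1) < n"
    by (rule exists_basis_distinct_degrees) blast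
  define W where "W = wronskian d (\<lambda>k. poly (b k) 1)"
  \<comment> \<open>The points in the affine chart, where the multiplicities are those of roots of
    \<open>W\<close>.\<close>
  define A where "A = {x \<in> S. fst (w x) \<noteq> 0}"
  have "W \<noteq> 0"
    unfolding W_def by (rule wronskian_nonzero[OF b(2,3)])
  have A: "(\<Sum>x\<in>A. part_size (l x)) \<le> degree W"
  proof (rule sum_multiplicities_le_degree[OF \<open>W \<noteq> 0\<close>])
    show "finite A" using assms(1) by (simp add: A_def)
    show "inj_on (\<lambda>x. snd (w x) / fst (w x)) A"
      by (intro inj_onI inj) (auto simp: A_def field_simps)
    show "[:snd (w x) / fst (w x), 1:] ^ part_size (l x) dvd W" if "x \<in> A" for x
      unfolding W_def using that
      by (intro Schubert_finite_point_dvd_wronskian[OF V' _ l \<open>d \<le> n\<close> \<open>0 < d\<close> b(1)]) (auto simp: A_def)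
  qed
  show ?thesis
  proof (cases "A = S")
    case True
    have "degree W \<le> d * (n - d)"
      unfolding W_def by (rule degree_wronskian_distinct_degrees[OF b(3,4)])
    with A True show ?thesis by simp
  next
    case False
    then obtain y where y: "y \<in> S" "fst (w y) = 0" by (auto simp: A_def)
    \<comment> \<open>By injectivity of \<open>\<psi>\<close> at most one point of \<open>S\<close>
      lies at infinity; there the degree drop of \<open>W\<close> makes up for the missing
      root.\<close>
    have "S = insert y A" "y \<notin> A"
      using y inj[of y] by (auto simp: A_def)
    then have "(\<Sum>x\<in>S. part_size (l x)) = part_size (l y) + (\<Sum>x\<in>A. part_size (l x))"
      using assms(1) by simp
    moreover have "degree W + part_size (l y) \<le> d * (n - d)"
      unfolding W_def
      using Schubert_infinity_degree_wronskian[OF V'[OF y(1)] w(1) y(2) l[OF y(1)] \<open>d \<le> n\<close> \<open>0 < d\<close> b(1)]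
      by simp
    ultimately show ?thesis using A by linarith
  qed
qed

section \<open>Degrees on a stable curve\<close>

lemma part_compl_size:
  assumes "l \<in> rect_partitions d n"
  shows "part_size (part_compl d n l) + part_size l = d * (n - d)"
proof -
  have "sum_list (map (\<lambda>a. n - d - a) (rev l)) = sum_list (map (\<lambda>a. n - d - a) l)"
    by (simp only: rev_map[symmetric] sum_list_rev)
  also have "\<dots> + sum_list l = length l * (n - d)" if "\<forall>a\<in>set l. a \<le> n - d"
    using that by (induction l) auto
  ultimately show ?thesis
    using assms by (simp add: part_compl_def rect_partitions_def)
qed

context stable_genus_zero_curve
begin

lemma card_nodes: "card (nodes v C) = v - 1"
  using genus_zero nonempty by (simp add: arithmetic_genus_def)

lemma finite_special_points: "finite (special_points v C r z j)"
  using finite_nodes by (simp add: special_points_def)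

lemma node_branches:
  assumes "x \<in> nodes v C"
  obtains j k where "j \<in> {1..v}" "k \<in> {1..v}" "j \<noteq> k" "x \<in> C j \<inter> C k"
    "{i \<in> {1..v}. x \<in> C i} = {j, k}"
proof -
  obtain j k where jk: "j \<in> {1..v}" "k \<in> {1..v}" "j \<noteq> k" "x \<in> C j \<inter> C k"
    using assms by (auto simp: nodes_def)
  \<comment> \<open>The two known branches already attain the maximal number allowed by
    \<open>two_branches\<close>.\<close>
  have "{j, k} = {i \<in> {1..v}. x \<in> C i}"
    using jk two_branches[of x] by (intro card_seteq) auto
  with jk that show ?thesis by metis
qed

lemma marked_branch:
  assumes "i \<in> {1..r}"
  obtains j where "j \<in> {1..v}" "z i \<in> C j" "{k \<in> {1..v}. z i \<in> C k} = {j}"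
proof -
  obtain j where "j \<in> {1..v}" "z i \<in> C j"
    using marked_points[OF assms] by blast
  moreover from this have "k = j" if "k \<in> {1..v}" "z i \<in> C k" for k
    using marked_points[OF assms] that unfolding nodes_def by blast
  ultimately have "{k \<in> {1..v}. z i \<in> C k} = {j}" by blast
  with \<open>j \<in> {1..v}\<close> \<open>z i \<in> C j\<close> show ?thesis using that by blast
qed

text \<open>Each node lies on two components, with complementary partitions of total size
  \<open>d * (n - d)\<close>, and a genus zero curve has one node less than components.\<close>

lemma sum_part_size_components:
  assumes rect: "\<And>j x. j \<in> {1..v} \<Longrightarrow> x \<in> special_points v C r z j \<Longrightarrow> \<nu> j x \<in> rect_partitions d n"
    and lam: "\<And>j i. j \<in> {1..v} \<Longrightarrow> i \<in> {1..r} \<Longrightarrow> z i \<in> C j \<Longrightarrow> \<nu> j (z i) = lam i"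
    and compl: "\<And>j k w. j \<in> {1..v} \<Longrightarrow> k \<in> {1..v} \<Longrightarrow> j \<noteq> k \<Longrightarrow> w \<in> C j \<inter> C k \<Longrightarrow>
      \<nu> j w = part_compl d n (\<nu> k w)"
    and total: "(\<Sum>i = 1..r. part_size (lam i)) = d * (n - d)"
  shows "(\<Sum>j = 1..v. \<Sum>x\<in>special_points v C r z j. part_size (\<nu> j x)) = v * (d * (n - d))"
proof -
  \<comment> \<open>Double counting: a sum over components and their points becomes a sum over
    points and the components through them.\<close>
  have swap: "(\<Sum>j = 1..v. \<Sum>x\<in>C j \<inter> A. part_size (\<nu> j x))
      = (\<Sum>x\<in>A. \<Sum>j\<in>{j \<in> {1..v}. x \<in> C j}. part_size (\<nu> j x))" if "finite A" for A
    using sum.swap_restrict[OF _ that, of "{1..v}" "\<lambda>j x. part_size (\<nu> j x)" "\<lambda>j x. x \<in> C j"]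
    by (simp add: Int_def conj_commute)
  have "(\<Sum>j = 1..v. \<Sum>x\<in>C j \<inter> z ` {1..r}. part_size (\<nu> j x))
      = (\<Sum>i = 1..r. \<Sum>j\<in>{j \<in> {1..v}. z i \<in> C j}. part_size (\<nu> j (z i)))"
    by (simp only: swap[OF finite_imageI[OF finite_atLeastAtMost]] sum.reindex[OF marked_distinct] comp_def)
  also have "\<dots> = (\<Sum>i = 1..r. part_size (lam i))"
  proof (rule sum.cong[OF refl])
    fix i assume i: "i \<in> {1..r}"
    obtain j where "j \<in> {1..v}" "z i \<in> C j" "{k \<in> {1..v}. z i \<in> C k} = {j}"
      by (rule marked_branch[OF i])
    then show "(\<Sum>j\<in>{j \<in> {1..v}. z i \<in> C j}. part_size (\<nu> j (z i))) = part_size (lam i)"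
      using lam i by simp
  qed
  finally have marked: "(\<Sum>j = 1..v. \<Sum>x\<in>C j \<inter> z ` {1..r}. part_size (\<nu> j x)) = d * (n - d)"
    using total by simp
  have "(\<Sum>j = 1..v. \<Sum>x\<in>C j \<inter> nodes v C. part_size (\<nu> j x))
      = (\<Sum>x\<in>nodes v C. \<Sum>j\<in>{j \<in> {1..v}. x \<in> C j}. part_size (\<nu> j x))"
    by (rule swap[OF finite_nodes])
  also have "\<dots> = (\<Sum>x\<in>nodes v C. d * (n - d))"
  proof (rule sum.cong[OF refl])
    fix x assume x: "x \<in> nodes v C"
    obtain j k where jk: "j \<in> {1..v}" "k \<in> {1..v}" "j \<noteq> k" "x \<in> C j \<inter> C k"
        "{i \<in> {1..v}. x \<in> C i} = {j, k}"
      by (rule node_branches[OF x])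
    have "x \<in> special_points v C r z k"
      using x jk(4) by (simp add: special_points_def)
    then have "part_size (\<nu> j x) + part_size (\<nu> k x) = d * (n - d)"
      unfolding compl[OF jk(1-4)] by (intro part_compl_size rect jk(2))
    then show "(\<Sum>j\<in>{j \<in> {1..v}. x \<in> C j}. part_size (\<nu> j x)) = d * (n - d)"
      unfolding jk(5) using jk(3) by simp
  qed
  finally have nodes: "(\<Sum>j = 1..v. \<Sum>x\<in>C j \<inter> nodes v C. part_size (\<nu> j x)) = (v - 1) * (d * (n - d))"
    by (simp add: card_nodes)
  \<comment> \<open>Marked points are not nodes, so the special points of a component split
    disjointly.\<close>
  have "(\<Sum>x\<in>special_points v C r z j. part_size (\<nu> j x))
      = (\<Sum>x\<in>C j \<inter> z ` {1..r}. part_size (\<nu> j x)) + (\<Sum>x\<in>C j \<inter> nodes v C. part_size (\<nu> j x))" for j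
    unfolding special_points_def Int_Un_distrib
    by (rule sum.union_disjoint) (use finite_nodes marked_points in auto)
  then have "(\<Sum>j = 1..v. \<Sum>x\<in>special_points v C r z j. part_size (\<nu> j x)) = d * (n - d) + (v - 1) * (d * (n - d))"
    by (simp only: sum.distrib marked nodes)
  then show ?thesis
    using nonempty by (simp add: mult_eq_if)
qed

end

section \<open>Comparison of the component sums with their average\<close>

theorem proposition1p3:
  fixes d n r v :: nat
    and lam :: "nat \<Rightarrow> nat list"
    and C :: "nat \<Rightarrow> 'p set" and \<phi> :: "nat \<Rightarrow> 'p \<Rightarrow> P1" and z :: "nat \<Rightarrow> 'p"
    and \<nu> :: "nat \<Rightarrow> 'p \<Rightarrow> nat list"
  assumes "d \<le> n" and "r \<ge> 3"
    and "\<And>i. i \<in> {1..r} \<Longrightarrow> lam i \<in> rect_partitions d n"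
    and "(\<Sum>i = 1..r. part_size (lam i)) = d * (n - d)"
    and "stable_genus_zero_curve v C \<phi> r z"
    and "\<And>j x. j \<in> {1..v} \<Longrightarrow> x \<in> special_points v C r z j \<Longrightarrow> \<nu> j x \<in> rect_partitions d n"
    and "\<And>j i. j \<in> {1..v} \<Longrightarrow> i \<in> {1..r} \<Longrightarrow> z i \<in> C j \<Longrightarrow> \<nu> j (z i) = lam i"
    and "\<And>j k w. j \<in> {1..v} \<Longrightarrow> k \<in> {1..v} \<Longrightarrow> j \<noteq> k \<Longrightarrow> w \<in> C j \<inter> C k \<Longrightarrow>
           \<nu> j w = part_compl d n (\<nu> k w)"
  shows "\<not> (\<forall>j\<in>{1..v}. (\<Sum>x\<in>special_points v C r z j. part_size (\<nu> j x)) = d * (n - d))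
    \<longrightarrow> (\<Pi>\<^sub>E j\<in>{1..v}. \<Inter>x\<in>special_points v C r z j.
           Schubert d n (\<nu> j x) (osculating_flag n (\<phi> j x))) = {}"
proof (rule impI, rule ccontr)
  assume unbalanced: "\<not> (\<forall>j\<in>{1..v}. (\<Sum>x\<in>special_points v C r z j. part_size (\<nu> j x)) = d * (n - d))"
  assume "(\<Pi>\<^sub>E j\<in>{1..v}. \<Inter>x\<in>special_points v C r z j.
           Schubert d n (\<nu> j x) (osculating_flag n (\<phi> j x))) \<noteq> {}"
  then obtain V where "V \<in> (\<Pi>\<^sub>E j\<in>{1..v}. \<Inter>x\<in>special_points v C r z j.
           Schubert d n (\<nu> j x) (osculating_flag n (\<phi> j x)))"
    by blast
  then have V: "V j \<in> Schubert d n (\<nu> j x) (osculating_flag n (\<phi> j x))"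
    if "j \<in> {1..v}" "x \<in> special_points v C r z j" for j x
    using that by (auto dest: PiE_mem)
  interpret stable_genus_zero_curve v C \<phi> r z by fact
  have le: "(\<Sum>x\<in>special_points v C r z j. part_size (\<nu> j x)) \<le> d * (n - d)" if j: "j \<in> {1..v}" for j
  proof (rule Schubert_intersection_sum_le[OF finite_special_points _ _ \<open>d \<le> n\<close> assms(6)[OF j] V[OF j]])
    \<comment> \<open>Stability supplies a special point; an intersection over no points would be
      \<open>UNIV\<close> and would impose no condition on \<open>V j\<close>.\<close>
    show "special_points v C r z j \<noteq> {}"
      using stable[OF j] by auto
    show "inj_on (\<phi> j) (special_points v C r z j)"
      using components[OF j] by (auto simp: bij_betw_def special_points_def intro: inj_on_subset)
  qed
  from unbalanced obtain k where k: "k \<in> {1..v}"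
    "(\<Sum>x\<in>special_points v C r z k. part_size (\<nu> k x)) \<noteq> d * (n - d)"
    by blast
  with le[OF k(1)] have "(\<Sum>x\<in>special_points v C r z k. part_size (\<nu> k x)) < d * (n - d)"
    by linarith
  \<comment> \<open>A point of the product bounds every component sum by \<open>d * (n - d)\<close>.
    One strict inequality would push the total below \<open>v * (d * (n - d))\<close>, its exact
    value.\<close>
  then have "(\<Sum>j = 1..v. \<Sum>x\<in>special_points v C r z j. part_size (\<nu> j x)) < (\<Sum>j = 1..v. d * (n - d))"
    using le k(1) by (intro sum_strict_mono_ex1) auto
  with sum_part_size_components[of \<nu> d n lam, OF assms(6,7,8,4)] show False
    by simp
qed

end
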